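(* Let $a\in(0,1/2]$. The function $r\mapsto \frac{R(a)}{2}-\mu_a(r)-\log r$ is absolutely monotonic on $(0,1)$. Consequently, the function $r\mapsto\mu_a(r)+\log r$ is strictly decreasing and concave on $(0,1)$.
   Context: A function $f$ is called absolutely monotonic on an interval $I$ if it has nonnegative derivatives of all orders on $I$, that is, $f^{(n)}(x)\ge 0$ for all $x\in I$ and all $n\ge 0$. $F(\alpha,\beta;c;x)=\sum_{n=0}^\infty\frac{(\alpha)_n(\beta)_n}{(c)_n}\frac{x^n}{n!}$, $|x|<1$, is the Gaussian hypergeometric function, with $(x)_0=1$, $(x)_n=x(x+1)\cdots(x+n-1)$. The generalized Grötzsch ring function is $\mu_a(r)=\frac{\pi}{2\sin(\pi a)}\frac{F(a,1-a;1;1-r^2)}{F(a,1-a;1;r^2)}$ for $r\in(0,1)$. The Ramanujan constant is $R(a)=-2\gamma-\psi(a)-\psi(1-a)$, where $\psi=\Gamma'/\Gamma$ is the digamma function and $\gamma$ is the Euler–Mascheroni constant. *)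

theory Defs
  imports "HOL-Analysis.Analysis"
begin

text \<open>\<open>D n\<close> is the \<open>n\<close>-th derivative of \<open>f\<close> on \<open>I\<close>, one-sided at any end point of the interval
  \<open>I\<close> that belongs to \<open>I\<close>; its existence is part of the definition. On a nondegenerate interval
  the values \<open>D n x\<close> with \<open>x \<in> I\<close> are uniquely determined by \<open>f\<close>.\<close>

definition absolutely_monotonic_on :: "real set \<Rightarrow> (real \<Rightarrow> real) \<Rightarrow> bool" where
  "absolutely_monotonic_on I f \<longleftrightarrow>
     (\<exists>D :: nat \<Rightarrow> real \<Rightarrow> real. D 0 = f \<and>
        (\<forall>n. \<forall>x\<in>I. (D n has_real_derivative D (Suc n) x) (at x within I)) \<and>
        (\<forall>n. \<forall>x\<in>I. D n x \<ge> 0))"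

definition hypergeom_F :: "real \<Rightarrow> real \<Rightarrow> real \<Rightarrow> real \<Rightarrow> real" where
  "hypergeom_F \<alpha> \<beta> c x =
     (\<Sum>n. pochhammer \<alpha> n * pochhammer \<beta> n / pochhammer c n * (x ^ n / fact n))"

definition groetzsch_mu :: "real \<Rightarrow> real \<Rightarrow> real" where
  "groetzsch_mu a r =
     pi / (2 * sin (pi * a)) *
     (hypergeom_F a (1 - a) 1 (1 - r\<^sup>2) / hypergeom_F a (1 - a) 1 (r\<^sup>2))"

definition ramanujan_R :: "real \<Rightarrow> real" where
  "ramanujan_R a = - 2 * euler_mascheroni - Digamma a - Digamma (1 - a)"

end

theory Submission
  imports Defs "HOL-Real_Asymp.Real_Asymp"
begin

text \<open>
  Write \<open>F(x) = F(a,1-a;1;x) = \<Sum> c\<^sub>n x\<^sup>n\<close> and \<open>k = \<pi> / sin (\<pi> a) = \<Gamma>(a) \<Gamma>(1-a)\<close>, so that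
  \<open>2 \<mu>\<^sub>a(r) = k F(1-x) / F(x)\<close> with \<open>x = r\<^sup>2\<close>. Both \<open>F(x)\<close> and \<open>k F(1-x)\<close> solve the hypergeometric
  equation \<open>(x(1-x)y')' = a(1-a) y\<close>. So does \<open>F(x) ln x + E(x)\<close>, where
  \<open>E(x) = \<Sum> c\<^sub>n d\<^sub>n x\<^sup>n\<close> and \<open>d\<^sub>n = \<Sum>k<n. 1/(a+k) + 1/(1-a+k) - 2/(k+1)\<close>. Comparing Wronskians,
  \<open>k F(1-x) / F(x) + w (ln x + E(x) / F(x))\<close> is a constant \<open>C\<close> on \<open>(0,1)\<close> for some \<open>w\<close>. The behaviour at
  \<open>0\<close> gives \<open>w = 1\<close> and \<open>C \<le> R(a)\<close>, hence

    \<open>R(a)/2 - \<mu>\<^sub>a(r) - ln r = (R(a) - C)/2 + E(r\<^sup>2) / (2 F(r\<^sup>2))\<close>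

  (lemma \<open>hypergeom_connection\<close>). The Taylor coefficients of the right-hand side are nonnegative: the sequence
  \<open>c\<close> is log-convex, so by Kaluza's theorem all coefficients of \<open>1/F\<close> but the first are \<open>\<le> 0\<close>, and as \<open>d\<close>
  increases from \<open>0\<close> this makes those of \<open>E/F\<close> nonnegative (lemma \<open>fps_quotient_nonneg\<close>).
  Absolute monotonicity, the sign of the first and second derivative, and hence the monotonicity and concavity
  of \<open>\<mu>\<^sub>a(r) + ln r\<close> follow.

  The bound \<open>C \<le> R(a)\<close> is where the digamma function enters. It rests on
  \<open>\<Sum> (k c\<^sub>n - 1/(n+1)) = R(a)\<close>, a series with nonnegative terms whose value bounds
  \<open>k F(y) + ln (1-y)/y\<close> (lemma \<open>hyp_log_singularity\<close>). In place of the limit of Gauss's summation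
  formula, its value is found by shifting the parameters of the more general terms
  \<open>\<Gamma>(a+n) \<Gamma>(b+n) / (n! \<Gamma>(a+b+n))\<close> to infinity (theorem \<open>beta_term_minus_harmonic_sums\<close>).
\<close>

section \<open>A series of Beta values with sum R(a, b)\<close>

text \<open>For \<open>b = 1 - a\<close> these are the coefficients of \<open>\<Gamma>(a) \<Gamma>(1-a) F(a,1-a;1;x)\<close>; the second parameter is kept
  free because the parameters are going to be shifted independently.\<close>

definition beta_term :: "real \<Rightarrow> real \<Rightarrow> nat \<Rightarrow> real" where
  "beta_term a b n = Gamma (a + n) * Gamma (b + n) / (fact n * Gamma (a + b + n))"

lemma beta_term_commute: "beta_term a b n = beta_term b a n"
  by (simp add: beta_term_def add_ac mult_ac)

lemma beta_term_1_1: "beta_term 1 1 n = 1 / (n + 1)"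
proof -
  have "Gamma (1 + real n) = fact n" by (rule Gamma_fact)
  moreover have "Gamma (2 + real n) = fact (n + 1)" using Gamma_fact[of "n + 1", where 'a = real] by (simp add: add_ac)
  ultimately show ?thesis by (simp add: beta_term_def add_ac)
qed

text \<open>Raising a parameter by one changes the term by a difference that telescopes: this is Gosper's algorithm
  for the summand \<open>b \<Gamma>(a+n) \<Gamma>(b+n) / (n! \<Gamma>(a+b+n+1))\<close>.\<close>

lemma sum_beta_term_shift:
  assumes "a > 0" "b > 0"
  shows "(\<Sum>n<N. beta_term a b n - beta_term (a + 1) b n) = N * beta_term a b N / a"
proof (induction N)
  case (Suc N)
  have G: "Gamma (1 + (x + real N)) = (x + N) * Gamma (x + N)" if "x > 0" for x :: real
    using Gamma_plus1[of "x + real N"] that by (force simp: add_ac elim!: nonpos_Ints_cases)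
  have pos: "Gamma (a + b + N) > 0" "a + N > 0" "b + N > 0" "a + b + N > 0"
    using assms by (auto intro!: Gamma_real_pos add_pos_nonneg)
  define X D where "X = beta_term a b N" and "D = a + b + N"
  have nz: "D \<noteq> 0" "a \<noteq> 0" using pos assms unfolding D_def by linarith+
  have 1: "beta_term (a + 1) b N = X * (a + N) / D"
    using G[of a] G[of "a + b"] assms by (simp add: X_def D_def beta_term_def add_ac mult_ac)
  have 2: "(N + 1) * beta_term a b (Suc N) = X * (a + N) * (b + N) / D"
    using G[of a] G[of b] G[of "a + b"] assms by (simp add: X_def D_def beta_term_def add_ac mult_ac)
  have "(N * D + a * D - a * (a + N)) / (a * D) = (a + N) * (b + N) / (a * D)"
    by (simp add: D_def algebra_simps)
  then have "N / a + 1 - (a + N) / D = (a + N) * (b + N) / (a * D)"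
    using nz by (simp add: add_divide_distrib diff_divide_distrib)
  then have "X * (N / a + 1 - (a + N) / D) = X * ((a + N) * (b + N) / (a * D))" by simp
  then have "N * X / a + (X - X * (a + N) / D) = X * (a + N) * (b + N) / D / a"
    by (simp add: algebra_simps)
  also have "\<dots> = (N + 1) * beta_term a b (Suc N) / a" by (simp only: 2)
  finally show ?case
    unfolding sum.lessThan_Suc Suc.IH 1 by (simp add: X_def)
qed simp

text \<open>From \<open>\<Gamma>(z+N) \<sim> (N-1)! N\<^sup>z\<close>: the powers \<open>N\<^sup>a\<close>, \<open>N\<^sup>b\<close> and \<open>N\<^sup>a\<^sup>+\<^sup>b\<close> cancel.\<close>

lemma beta_term_asymp:
  assumes "a > 0" "b > 0"
  shows "(\<lambda>N. N * beta_term a b N) \<longlonglongrightarrow> 1"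
proof -
  have nn: "z \<notin> \<int>\<^sub>\<le>\<^sub>0" if "z > 0" for z :: real
    using that by (auto elim!: nonpos_Ints_cases)
  have lim: "(\<lambda>N. Gamma_series' (a + b) N * (Gamma a * Gamma b / Gamma (a + b)) / (Gamma_series' a N * Gamma_series' b N))
          \<longlonglongrightarrow> Gamma (a + b) * (Gamma a * Gamma b / Gamma (a + b)) / (Gamma a * Gamma b)"
    using assms by (intro tendsto_intros Gamma_series'_LIMSEQ) (auto simp: Gamma_eq_zero_iff nn)
  have pos: "Gamma a > 0" "Gamma b > 0" "Gamma (a + b) > 0" using assms by auto
  have lim1: "Gamma (a + b) * (Gamma a * Gamma b / Gamma (a + b)) / (Gamma a * Gamma b) = 1"
    using pos by simp
  have "eventually (\<lambda>N. Gamma_series' (a + b) N * (Gamma a * Gamma b / Gamma (a + b)) / (Gamma_series' a N * Gamma_series' b N)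
             = N * beta_term a b N) sequentially"
    using eventually_gt_at_top[of 0]
  proof eventually_elim
    case (elim N)
    have G: "Gamma (z + N) = Gamma z * pochhammer z N" if "z > 0" for z :: real
      using pochhammer_Gamma[OF nn[OF that], of N] that by (simp add: Gamma_eq_zero_iff nn)
    define M where "M = (fact (N - 1) :: real)"
    have fN: "fact N = N * M" using elim unfolding M_def by (simp add: fact_reduce)
    have "M > 0" by (simp add: M_def)
    define P Q where "P = exp (a * ln N)" and "Q = exp (b * ln N)"
    have "P > 0" "Q > 0" by (simp_all add: P_def Q_def)
    have e: "exp ((a + b) * ln N) = P * Q"
      by (simp add: P_def Q_def exp_add [symmetric] algebra_simps)
    have pn: "pochhammer a N > 0" "pochhammer b N > 0" "pochhammer (a + b) N > 0"
      using assms by (auto intro: pochhammer_pos)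
    show ?case
      unfolding beta_term_def Gamma_series'_def M_def[symmetric]
      using pn pos elim \<open>M > 0\<close> assms \<open>P > 0\<close> \<open>Q > 0\<close> G[of a] G[of b] G[of "a + b"]
      by (simp add: fN e mult_ac flip: P_def Q_def)
  qed
  with lim lim1 show ?thesis by (simp add: tendsto_cong)
qed

lemma beta_term_shift_sums:
  assumes "a > 0" "b > 0"
  shows "(\<lambda>n. beta_term a b n - beta_term (a + 1) b n) sums (1 / a)"
  unfolding sums_def sum_beta_term_shift[OF assms]
  using tendsto_divide[OF beta_term_asymp[OF assms] tendsto_const[of a]] assms by simp

lemma beta_term_shift_both_sums:
  assumes "a > 0" "b > 0"
  shows "(\<lambda>n. beta_term a b n - beta_term (a + real m) (b + real m) n)
           sums (\<Sum>k<m. 1 / (a + real k) + 1 / (b + real k))"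
proof (induction m)
  case (Suc m)
  have 1: "(\<lambda>n. beta_term (a + real m) (b + real m) n - beta_term (a + real m + 1) (b + real m) n) sums (1 / (a + real m))"
    using assms by (intro beta_term_shift_sums) auto
  have 2: "(\<lambda>n. beta_term (a + real m + 1) (b + real m) n - beta_term (a + real m + 1) (b + real m + 1) n) sums (1 / (b + real m))"
    using beta_term_shift_sums[of "b + real m" "a + real m + 1"] assms
    unfolding beta_term_commute[of "b + real m"] beta_term_commute[of "b + real m + 1"] by simp
  show ?case
    using sums_add[OF sums_add[OF Suc.IH 1] 2] by (simp add: add_ac)
qed simp

text \<open>The logarithmic derivative in \<open>a\<close> is \<open>\<psi>(a+n) - \<psi>(a+b+n)\<close>.\<close>

lemma beta_term_antimono1:
  assumes "0 < a" "a \<le> a'" "b > 0"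
  shows "beta_term a' b n \<le> beta_term a b n"
proof -
  define g where "g = (\<lambda>x::real. ln_Gamma (x + real n) - ln_Gamma (x + b + real n))"
  have "g a' \<le> g a"
  proof (rule DERIV_nonpos_imp_nonincreasing[OF \<open>a \<le> a'\<close>])
    fix x assume x: "a \<le> x" "x \<le> a'"
    have "(g has_real_derivative Digamma (x + n) - Digamma (x + b + n)) (at x)"
      unfolding g_def using x assms by (auto intro!: derivative_eq_intros)
    moreover have "Digamma (x + n) \<le> Digamma (x + b + n)"
      using x assms by (intro Digamma_real_mono) auto
    ultimately show "\<exists>y. (g has_real_derivative y) (at x) \<and> y \<le> 0" by force
  qed
  moreover have "exp (g x) = Gamma (x + n) / Gamma (x + b + n)" if "x > 0" for x
    using that assms by (simp add: g_def exp_diff Gamma_real_pos_exp add_pos_nonneg)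
  ultimately have "Gamma (a' + n) / Gamma (a' + b + n) \<le> Gamma (a + n) / Gamma (a + b + n)"
    using assms by (metis exp_le_cancel_iff less_le_trans)
  from mult_right_mono[OF this, of "Gamma (b + n) / fact n"] show ?thesis
    using assms by (simp add: beta_term_def mult_ac add_pos_nonneg less_imp_le)
qed

lemma beta_term_antimono:
  assumes "0 < a" "a \<le> a'" "0 < b" "b \<le> b'"
  shows "beta_term a' b' n \<le> beta_term a b n"
  using beta_term_antimono1[of a a' b' n] beta_term_antimono1[of b b' a n] assms
  by (simp add: beta_term_commute)

text \<open>Shift the parameters of both \<open>beta_term a b\<close> and \<open>beta_term 1 1\<close>, whose terms are \<open>1/(n+1)\<close>, by \<open>m\<close>. What is
  gained is a partial sum of the series for \<open>2 \<psi>(1) - \<psi>(a) - \<psi>(b)\<close>. By monotonicity the remainder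
  \<open>r m\<close> lies between \<open>0\<close> and \<open>\<Sum>n. beta_term m m n - beta_term (m+1) (m+1) n = 2/m\<close>, so it vanishes as \<open>m\<close> grows.\<close>

theorem beta_term_minus_harmonic_sums:
  assumes a: "0 < a" "a \<le> 1" and b: "0 < b" "b \<le> 1"
  shows "(\<lambda>n. beta_term a b n - 1 / (n + 1)) sums (- 2 * euler_mascheroni - Digamma a - Digamma b)"
proof -
  define u where "u = (\<lambda>n. beta_term a b n - beta_term 1 1 n)"
  define S where "S = (\<lambda>m. (\<Sum>k<m. 1 / (a + real k) + 1 / (b + real k)) - (\<Sum>k<m. 1 / (1 + real k) + 1 / (1 + real k)))"
  define r where "r = (\<lambda>m n. beta_term (a + real m) (b + real m) n - beta_term (1 + real m) (1 + real m) n)"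
  have ur: "(\<lambda>n. u n - r m n) sums S m" for m
    using sums_diff[OF beta_term_shift_both_sums[of a b m] beta_term_shift_both_sums[of 1 1 m]] a b
    by (simp add: u_def r_def S_def algebra_simps)
  have r0: "0 \<le> r m n" for m n
    using a b beta_term_antimono[of "a + m" "1 + m" "b + m" "1 + m" n] by (simp add: r_def)
  have r1: "r m n \<le> beta_term m m n - beta_term (m + 1) (m + 1) n" if "m > 0" for m n
    using a b that beta_term_antimono[of m "a + m" m "b + m" n] by (simp add: r_def add_ac)
  have bs: "(\<lambda>n. beta_term m m n - beta_term (m + 1) (m + 1) n) sums (2 / m)" if "m > 0" for m :: nat
    using beta_term_shift_both_sums[of m m 1] that by (simp add: add_ac)
  have rs: "summable (r m)" if "m > 0" for m
    using that by (intro summable_comparison_test[OF _ sums_summable[OF bs[OF that]]])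
       (use r0 r1 in auto)
  have rb: "0 \<le> suminf (r m) \<and> suminf (r m) \<le> 2 / m" if "m > 0" for m
    using suminf_nonneg[OF rs[OF that] r0] suminf_le[OF r1[OF that] rs[OF that] sums_summable[OF bs[OF that]]]
      sums_unique[OF bs[OF that]] by auto
  have us: "summable u"
    using summable_add[OF sums_summable[OF ur[of 1]] rs[of 1]] by simp
  have eq: "suminf u - suminf (r m) = S m" if "m > 0" for m
    using suminf_diff[OF us rs[OF that]] sums_unique[OF ur[of m]] by simp
  have "(\<lambda>m. suminf (r m)) \<longlonglongrightarrow> 0"
  proof (rule tendsto_sandwich[of "\<lambda>_. 0" _ _ "\<lambda>m. 2 / real m"])
    show "(\<lambda>m. 2 / real m) \<longlonglongrightarrow> 0" by (rule lim_const_over_n)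
    show "eventually (\<lambda>m. 0 \<le> suminf (r m)) sequentially" "eventually (\<lambda>m. suminf (r m) \<le> 2 / real m) sequentially"
      using eventually_gt_at_top[of 0] by (eventually_elim; use rb in blast)+
  qed auto
  then have "(\<lambda>m. suminf u - suminf (r m)) \<longlonglongrightarrow> suminf u - 0" by (intro tendsto_intros)
  moreover have "eventually (\<lambda>m. suminf u - suminf (r m) = S m) sequentially"
    using eventually_gt_at_top[of "0::nat"] by eventually_elim (use eq in auto)
  ultimately have 1: "S \<longlonglongrightarrow> suminf u"
    by (simp add: tendsto_cong)
  define L where "L = (\<lambda>z m. ln (real m) - (\<Sum>n<m. inverse (z + real n)))"
  have L: "L z \<longlonglongrightarrow> Digamma z" if "z > 0" for z
    using Digamma_LIMSEQ[of z] that unfolding L_def by simp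
  have "S = (\<lambda>m. 2 * L 1 m - L a m - L b m)"
    by (auto simp: S_def L_def sum.distrib inverse_eq_divide sum_distrib_left)
  moreover have "(\<lambda>m. 2 * L 1 m - L a m - L b m) \<longlonglongrightarrow> 2 * Digamma 1 - Digamma a - Digamma b"
    using a b by (intro tendsto_intros L) auto
  ultimately have "suminf u = - 2 * euler_mascheroni - Digamma a - Digamma b"
    using LIMSEQ_unique[OF 1] by simp
  then show ?thesis using summable_sums[OF us] by (simp add: u_def beta_term_1_1 add_ac)
qed

section \<open>Quotients of power series with log-convex denominator\<close>

text \<open>Kaluza's theorem. Subtracting \<open>c\<^sub>n / c\<^sub>n\<^sub>-\<^sub>1\<close> times the convolution identity for index \<open>n-1\<close> from the one for
  index \<open>n\<close> removes the coefficient of index \<open>0\<close>, the only positive one; log-convexity gives the remaining terms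
  a definite sign.\<close>

lemma kaluza_inverse_nonpos:
  fixes f :: "real fps"
  assumes pos: "\<And>n. fps_nth f n > 0"
    and logconvex: "\<And>n. (fps_nth f (Suc n))\<^sup>2 \<le> fps_nth f n * fps_nth f (Suc (Suc n))"
    and "n > 0"
  shows "fps_nth (inverse f) n \<le> 0"
  using \<open>n > 0\<close>
proof (induction n rule: less_induct)
  case (less n)
  define c where "c = fps_nth f"
  define k where "k = fps_nth (inverse f)"
  have cpos: "c n > 0" for n using pos by (simp add: c_def)
  have conv: "(\<Sum>i=0..n. k i * c (n - i)) = (if n = 0 then 1 else 0)" for n
  proof -
    have "inverse f * f = 1" using pos[of 0] by (intro inverse_mult_eq_1) auto
    then show ?thesis by (metis fps_mult_nth fps_one_nth c_def k_def)
  qed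
  have ratio: "c (Suc i) / c i \<le> c (Suc j) / c j" if "i \<le> j" for i j
    using that
  proof (rule lift_Suc_mono_le[rotated])
    show "c (Suc n) / c n \<le> c (Suc (Suc n)) / c (Suc n)" for n
      using logconvex[of n] cpos[of n] cpos[of "Suc n"]
      by (simp add: c_def[symmetric] power2_eq_square field_simps)
  qed
  obtain m where m: "n = Suc m" using less.prems by (cases n) auto
  define \<rho> where "\<rho> = c (Suc m) / c m"
  have 0: "k 0 * c n + (\<Sum>i=1..m. k i * c (n - i)) + k n * c 0 = 0"
    using conv[of n] by (simp add: m sum.atLeast_Suc_atMost)
  have rho: "\<rho> * c m = c n" using cpos[of m] by (simp add: \<rho>_def m)
  have "(\<Sum>i=1..m. k i * c (n - i)) \<ge> (\<Sum>i=1..m. k i * (\<rho> * c (m - i)))"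
  proof (rule sum_mono)
    fix i assume i: "i \<in> {1..m}"
    have "k i \<le> 0" using less.IH[of i] i by (simp add: m k_def)
    moreover have "c (n - i) \<le> \<rho> * c (m - i)"
      using ratio[of "m - i" m] cpos[of "m - i"] i by (simp add: \<rho>_def m field_simps Suc_diff_le)
    ultimately show "k i * (\<rho> * c (m - i)) \<le> k i * c (n - i)" by (rule mult_left_mono_neg[rotated])
  qed
  moreover have "k 0 * c n + (\<Sum>i=1..m. k i * (\<rho> * c (m - i))) = \<rho> * (\<Sum>i=0..m. k i * c (m - i))"
    by (simp add: sum.atLeast_Suc_atMost sum_distrib_left algebra_simps flip: rho)
  moreover have "\<rho> * (\<Sum>i=0..m. k i * c (m - i)) \<ge> 0"
    unfolding conv using cpos by (simp add: \<rho>_def less_imp_le)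
  ultimately have "k n * c 0 \<le> 0" using 0 by linarith
  then show ?case using cpos[of 0] by (simp add: k_def mult_le_0_iff)
qed

text \<open>Let \<open>k\<close> be the coefficients of \<open>1/f\<close>. For \<open>n > 0\<close> the convolution of \<open>f\<close> with \<open>k\<close> vanishes, so
  \<open>q\<^sub>n = \<Sum>i<n. f\<^sub>i (d\<^sub>i - d\<^sub>n) k\<^sub>n\<^sub>-\<^sub>i\<close>, a sum of products of two nonpositive factors. The upper bound, obtained by dropping
  the nonpositive summands of \<open>q\<^sub>n = \<Sum>i\<le>n. f\<^sub>i d\<^sub>i k\<^sub>n\<^sub>-\<^sub>i\<close>, controls the radius of convergence of the quotient without any
  knowledge of the complex zeros of \<open>f\<close>.\<close>

lemma fps_quotient_nonneg:
  fixes f :: "real fps"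
  assumes pos: "\<And>n. fps_nth f n > 0"
    and logconvex: "\<And>n. (fps_nth f (Suc n))\<^sup>2 \<le> fps_nth f n * fps_nth f (Suc (Suc n))"
    and d: "mono d" "d 0 \<ge> 0"
  defines "q \<equiv> Abs_fps (\<lambda>n. fps_nth f n * d n) * inverse f"
  shows "0 \<le> fps_nth q n" and "fps_nth q n \<le> fps_nth f n * d n / fps_nth f 0"
proof -
  define c where "c = fps_nth f"
  define k where "k = fps_nth (inverse f)"
  have cpos: "c n > 0" for n using pos by (simp add: c_def)
  have dpos: "d n \<ge> 0" for n using d monoD[OF d(1), of 0 n] by simp
  have k0: "k 0 = 1 / c 0" by (simp add: k_def c_def fps_inverse_def inverse_eq_divide)
  have kneg: "k n \<le> 0" if "n > 0" for n
    unfolding k_def by (rule kaluza_inverse_nonpos[OF pos logconvex that])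
  have conv: "(\<Sum>i=0..n. c i * k (n - i)) \<ge> 0" for n
  proof -
    have "f * inverse f = 1" using pos[of 0] by (subst mult.commute, intro inverse_mult_eq_1) auto
    then have "(\<Sum>i=0..n. c i * k (n - i)) = (if n = 0 then 1 else 0)"
      by (metis fps_mult_nth fps_one_nth c_def k_def)
    then show ?thesis by simp
  qed
  have q: "fps_nth q n = (\<Sum>i=0..n. c i * d i * k (n - i))"
    by (simp add: q_def fps_mult_nth c_def k_def)
  have "0 \<le> (\<Sum>i=0..n. c i * k (n - i)) * d n" using conv dpos by simp
  also have "\<dots> = (\<Sum>i=0..n. (c i * d n) * k (n - i))" by (simp add: sum_distrib_left mult_ac)
  also have "\<dots> \<le> (\<Sum>i=0..n. c i * d i * k (n - i))"
  proof (rule sum_mono)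
    fix i assume i: "i \<in> {0..n}"
    show "(c i * d n) * k (n - i) \<le> c i * d i * k (n - i)"
    proof (cases "i = n")
      case False
      then have "k (n - i) \<le> 0" using kneg i by simp
      moreover have "c i * d i \<le> c i * d n"
        using i cpos[of i] monoD[OF d(1), of i n] by simp
      ultimately show ?thesis by (rule mult_right_mono_neg[rotated])
    qed simp
  qed
  finally show "0 \<le> fps_nth q n" by (simp add: q)
  have "(\<Sum>i<n. c i * d i * k (n - i)) \<le> 0"
    by (intro sum_nonpos mult_nonneg_nonpos mult_nonneg_nonneg dpos kneg less_imp_le[OF cpos]) auto
  then show "fps_nth q n \<le> fps_nth f n * d n / fps_nth f 0"
    unfolding q atLeast0AtMost lessThan_Suc_atMost[symmetric] sum.lessThan_Suc
    by (simp add: k0 c_def)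
qed

section \<open>Power series with radius of convergence at least one\<close>

lemma fps_conv_radius_ge_1:
  fixes f :: "real fps"
  assumes "\<And>n. \<bar>fps_nth f n\<bar> \<le> C * (real n + 1)"
  shows "fps_conv_radius f \<ge> 1"
  unfolding fps_conv_radius_def
proof (rule conv_radius_geI_ex)
  fix r :: real assume r: "0 < r" "ereal r < 1"
  have "ereal (norm r) < conv_radius (\<lambda>n. fps_nth (fps_deriv (Abs_fps (\<lambda>n. 1 :: real))) n)"
  proof -
    have "ereal (norm r) < 1" using r by simp
    also have "1 \<le> fps_conv_radius (Abs_fps (\<lambda>n. 1 :: real))"
      unfolding fps_conv_radius_def
    proof (rule conv_radius_geI_ex)
      fix t :: real assume "0 < t" "ereal t < 1"
      then show "\<exists>z. norm z = t \<and> summable (\<lambda>n. fps_nth (Abs_fps (\<lambda>n. 1 :: real)) n * z ^ n)"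
        by (intro exI[of _ t]) (simp add: summable_geometric)
    qed
    also note fps_conv_radius_deriv
    finally show ?thesis by (simp only: fps_conv_radius_def)
  qed
  then have "summable (\<lambda>n. fps_nth (fps_deriv (Abs_fps (\<lambda>n. 1 :: real))) n * r ^ n)"
    by (rule summable_in_conv_radius)
  then have "summable (\<lambda>n. C * ((real n + 1) * r ^ n))"
    by (intro summable_mult) (simp add: add_ac)
  then have "summable (\<lambda>n. fps_nth f n * r ^ n)"
  proof (rule summable_comparison_test[rotated])
    show "\<exists>N. \<forall>n\<ge>N. norm (fps_nth f n * r ^ n) \<le> C * ((real n + 1) * r ^ n)"
      using mult_right_mono[OF assms, of "r ^ n" for n] r by (auto simp: abs_mult mult_ac)
  qed
  then show "\<exists>z. norm z = r \<and> summable (\<lambda>n. fps_nth f n * z ^ n)"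
    using r by (intro exI[of _ r]) auto
qed

lemma less_conv_radius:
  fixes x :: real and f :: "real fps"
  assumes "\<bar>x\<bar> < 1" "fps_conv_radius f \<ge> 1"
  shows "ereal (norm x) < fps_conv_radius f" "ereal \<bar>x\<bar> < fps_conv_radius f"
  by (rule less_le_trans[OF _ assms(2)]; use assms(1) in simp)+

lemma conv_radius_deriv_ge_1:
  fixes f :: "real fps"
  shows "fps_conv_radius f \<ge> 1 \<Longrightarrow> fps_conv_radius (fps_deriv f) \<ge> 1"
  using fps_conv_radius_deriv order_trans by blast

lemma conv_radius_mult_ge_1:
  fixes f g :: "real fps"
  shows "fps_conv_radius f \<ge> 1 \<Longrightarrow> fps_conv_radius g \<ge> 1 \<Longrightarrow> fps_conv_radius (f * g) \<ge> 1"
  by (rule order_trans[OF _ fps_conv_radius_mult]) simp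

lemma conv_radius_add_ge_1:
  fixes f g :: "real fps"
  shows "fps_conv_radius f \<ge> 1 \<Longrightarrow> fps_conv_radius g \<ge> 1 \<Longrightarrow> fps_conv_radius (f + g) \<ge> 1"
  by (rule order_trans[OF _ fps_conv_radius_add]) simp

lemma conv_radius_diff_ge_1:
  fixes f g :: "real fps"
  shows "fps_conv_radius f \<ge> 1 \<Longrightarrow> fps_conv_radius g \<ge> 1 \<Longrightarrow> fps_conv_radius (f - g) \<ge> 1"
  by (rule order_trans[OF _ fps_conv_radius_diff]) simp

lemma derivatives_of_nonneg_power_series:
  fixes p :: "real fps"
  assumes rad: "fps_conv_radius p \<ge> 1" and nonneg: "\<And>n. fps_nth p n \<ge> 0"
    and f: "\<And>x. x \<in> {0<..<1} \<Longrightarrow> f x = eval_fps p x"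
  obtains D where "D 0 = f" "\<And>n. D (Suc n) = eval_fps ((fps_deriv ^^ Suc n) p)"
    "\<And>n x. x \<in> {0<..<1} \<Longrightarrow> (D n has_real_derivative D (Suc n) x) (at x)"
    "\<And>n x. x \<in> {0<..<1} \<Longrightarrow> D n x \<ge> 0"
proof -
  define P where "P = (\<lambda>n. (fps_deriv ^^ n) p)"
  \<comment> \<open>\<open>f\<close> is the sum of the series on \<open>(0,1)\<close> only, while \<open>D 0\<close> has to equal \<open>f\<close> as a function on all reals.\<close>
  define D where "D = (\<lambda>n. if n = 0 then f else eval_fps (P n))"
  have P_nonneg: "fps_nth (P n) k \<ge> 0" for n k
    by (induction n arbitrary: k) (auto simp: P_def nonneg)
  have P_rad: "fps_conv_radius (P n) \<ge> 1" for n
    by (induction n) (auto simp: P_def rad intro!: conv_radius_deriv_ge_1)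
  have less: "ereal (norm x) < fps_conv_radius (P n)" if "x \<in> {0<..<1}" for x :: real and n
    using that by (intro less_conv_radius(1) P_rad) auto
  have D_eq: "D n x = eval_fps (P n) x" if "x \<in> {0<..<1}" for n x
    using f[OF that] by (simp add: D_def P_def)
  have 1: "D 0 = f" by (simp add: D_def)
  have 2: "D (Suc n) = eval_fps ((fps_deriv ^^ Suc n) p)" for n by (simp add: D_def P_def)
  have 4: "D n x \<ge> 0" if "x \<in> {0<..<1}" for n x
    unfolding D_eq[OF that]
    by (rule sums_le[OF _ sums_zero sums_eval_fps[OF less[OF that]]]) (use that P_nonneg in simp)
  have 3: "(D n has_real_derivative D (Suc n) x) (at x)" if x: "x \<in> {0<..<1}" for n x
  proof (rule has_field_derivative_transform_within_open[of "eval_fps (P n)" _ _ "{0<..<1}"])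
    have "(eval_fps (P n) has_real_derivative eval_fps (fps_deriv (P n)) x) (at x)"
      by (rule has_field_derivative_eval_fps[OF less[OF x]])
    then show "(eval_fps (P n) has_real_derivative D (Suc n) x) (at x)"
      by (simp add: D_def P_def)
  qed (use x in \<open>auto simp: D_eq\<close>)
  show ?thesis by (rule that[of D]) (fact 1 2 3 4)+
qed

lemma eval_even_fps:
  fixes q :: "real fps"
  assumes "\<bar>r\<bar> < 1" "fps_conv_radius q \<ge> 1"
  shows "eval_fps (Abs_fps (\<lambda>n. if even n then fps_nth q (n div 2) else 0)) r = eval_fps q (r\<^sup>2)"
proof -
  define p where "p = (\<lambda>n. (if even n then fps_nth q (n div 2) else 0) * r ^ n)"
  have "\<bar>r\<^sup>2\<bar> < 1" using assms by (simp add: abs_square_less_1)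
  then have "(\<lambda>n. fps_nth q n * (r\<^sup>2) ^ n) sums eval_fps q (r\<^sup>2)"
    using assms by (intro sums_eval_fps less_conv_radius(1))
  then have "(\<lambda>n. p (2 * n)) sums eval_fps q (r\<^sup>2)"
    by (simp add: p_def power_mult)
  moreover have "(\<lambda>n. p (2 * n)) sums c \<longleftrightarrow> p sums c" for c
    by (rule sums_mono_reindex) (auto simp: strict_mono_def p_def elim!: evenE)
  ultimately have "p sums eval_fps q (r\<^sup>2)" by blast
  from sums_unique[OF this] show ?thesis by (simp add: eval_fps_def p_def)
qed

section \<open>The hypergeometric series and its logarithmic companion\<close>

definition hyp_coeff :: "real \<Rightarrow> nat \<Rightarrow> real" where
  "hyp_coeff a n = pochhammer a n * pochhammer (1 - a) n / (fact n)\<^sup>2"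

text \<open>This is \<open>R(a) - R\<^sub>n\<close>, where \<open>R\<^sub>n = 2 \<psi>(n+1) - \<psi>(a+n) - \<psi>(1-a+n)\<close> are the numbers that multiply the
  coefficients in the classical logarithmic expansion of \<open>F(a,1-a;1;1-x)\<close> at \<open>0\<close>.\<close>

definition digamma_gap :: "real \<Rightarrow> nat \<Rightarrow> real" where
  "digamma_gap a n = (\<Sum>k<n. 1 / (a + real k) + 1 / (1 - a + real k) - 2 / (real k + 1))"

definition hyp_fps :: "real \<Rightarrow> real fps" where
  "hyp_fps a = Abs_fps (hyp_coeff a)"

text \<open>The regular part of the logarithmic solution: adding \<open>F(x) ln x\<close> gives a second solution of the
  hypergeometric equation.\<close>

definition log_fps :: "real \<Rightarrow> real fps" where
  "log_fps a = Abs_fps (\<lambda>n. hyp_coeff a n * digamma_gap a n)"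

lemma hypergeom_F_eq_eval_fps: "hypergeom_F a (1 - a) 1 x = eval_fps (hyp_fps a) x"
  by (simp add: hypergeom_F_def eval_fps_def hyp_fps_def hyp_coeff_def pochhammer_fact[symmetric] power2_eq_square)

lemma hyp_coeff_0 [simp]: "hyp_coeff a 0 = 1" by (simp add: hyp_coeff_def)

lemma hyp_coeff_Suc:
  "(real n + 1)\<^sup>2 * hyp_coeff a (Suc n) = (a + n) * (1 - a + n) * hyp_coeff a n"
  by (simp add: hyp_coeff_def pochhammer_Suc power_mult_distrib divide_simps add_ac)

lemma hyp_coeff_Suc': "hyp_coeff a (Suc n) = (a + n) * (1 - a + n) / (real n + 1)\<^sup>2 * hyp_coeff a n"
  using hyp_coeff_Suc[of n a] by (simp add: field_simps)

lemma digamma_gap_Suc: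
  "digamma_gap a (Suc n) = digamma_gap a n + (1 / (a + n) + 1 / (1 - a + n) - 2 / (real n + 1))"
  by (simp add: digamma_gap_def)

lemma fps_nth_hypergeom_operator:
  fixes G :: "real fps"
  shows "fps_nth (fps_deriv (fps_X * (1 - fps_X) * fps_deriv G)) n
       = (real n + 1)\<^sup>2 * fps_nth G (Suc n) - real n * (real n + 1) * fps_nth G n"
proof -
  have "fps_X * (1 - fps_X) * fps_deriv G = fps_X * (fps_deriv G - fps_X * fps_deriv G)"
    by (simp add: algebra_simps)
  then show ?thesis
    by (subst fps_deriv_nth) (cases n; simp add: algebra_simps power2_eq_square)
qed

lemma quarter_bound: "a * (1 - a) \<le> (1 / 4 :: real)"
  using zero_le_power2[of "a - 1/2"] by (simp add: power2_eq_square algebra_simps)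

context
  fixes a :: real assumes a: "0 < a" "a < 1"
begin

lemma hyp_coeff_pos: "hyp_coeff a n > 0"
  using a by (auto simp: hyp_coeff_def intro!: divide_pos_pos mult_pos_pos pochhammer_pos)

lemma hyp_coeff_le_1: "hyp_coeff a n \<le> 1"
proof (induction n)
  case (Suc n)
  have "(a + n) * (1 - a + n) \<le> (real n + 1)\<^sup>2"
    using quarter_bound[of a] by (simp add: power2_eq_square algebra_simps)
  then have "(a + n) * (1 - a + n) / (real n + 1)\<^sup>2 \<le> 1" by simp
  from mult_mono[OF this Suc.IH] hyp_coeff_pos[of n] show ?case
    by (simp add: hyp_coeff_Suc' less_imp_le)
qed simp

text \<open>With \<open>u = n + 1\<close> and \<open>s = a(1-a)\<close> the ratio of consecutive coefficients is \<open>1 - 1/u + s/u\<^sup>2\<close>, which increases with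
  \<open>u \<ge> 1\<close> since \<open>s \<le> 1/4\<close>.\<close>

lemma hyp_coeff_log_convex: "(hyp_coeff a (Suc n))\<^sup>2 \<le> hyp_coeff a n * hyp_coeff a (Suc (Suc n))"
proof -
  define s where "s = a * (1 - a)"
  define u where "u = real n + 1"
  have u: "u \<ge> 1" by (simp add: u_def)
  have s: "s \<le> 1/4" using quarter_bound by (simp add: s_def)
  have 1: "(a + n) * (1 - a + n) = u\<^sup>2 - u + s"
    by (simp add: u_def s_def algebra_simps power2_eq_square)
  have 2: "(a + Suc n) * (1 - a + Suc n) = u\<^sup>2 + u + s"
    by (simp add: u_def s_def algebra_simps power2_eq_square)
  have "(u\<^sup>2 - u + s) * (u + 1)\<^sup>2 \<le> (u\<^sup>2 + u + s) * u\<^sup>2"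
  proof -
    have "u\<^sup>2 + u - s * (2 * u + 1) = (u\<^sup>2 + u + s) * u\<^sup>2 - (u\<^sup>2 - u + s) * (u + 1)\<^sup>2"
      by (simp add: power2_eq_square algebra_simps)
    moreover have "s * (2 * u + 1) \<le> 1/4 * (2 * u + 1)" using s u by (intro mult_right_mono) auto
    moreover have "u * 1 \<le> u * u" using u by (intro mult_left_mono) auto
    hence "u \<le> u\<^sup>2" by (simp add: power2_eq_square)
    ultimately have "(u\<^sup>2 + u + s) * u\<^sup>2 - (u\<^sup>2 - u + s) * (u + 1)\<^sup>2 \<ge> 0"
      using u by argo
    then show ?thesis by simp
  qed
  then have "(u\<^sup>2 - u + s) / u\<^sup>2 \<le> (u\<^sup>2 + u + s) / (u + 1)\<^sup>2"
    using u by (simp add: divide_simps mult_ac)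
  then have "(u\<^sup>2 - u + s) / u\<^sup>2 * (hyp_coeff a n * hyp_coeff a (Suc n))
        \<le> (u\<^sup>2 + u + s) / (u + 1)\<^sup>2 * (hyp_coeff a n * hyp_coeff a (Suc n))"
    by (rule mult_right_mono) (simp add: hyp_coeff_pos less_imp_le)
  moreover have "hyp_coeff a (Suc n) = (u\<^sup>2 - u + s) / u\<^sup>2 * hyp_coeff a n"
    using hyp_coeff_Suc'[of a n] unfolding 1 by (simp add: u_def)
  moreover have "hyp_coeff a (Suc (Suc n)) = (u\<^sup>2 + u + s) / (u + 1)\<^sup>2 * hyp_coeff a (Suc n)"
    using hyp_coeff_Suc'[of a "Suc n"] unfolding 2 by (simp add: u_def add_ac)
  ultimately show ?thesis by (simp add: power2_eq_square mult_ac)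
qed

lemma digamma_gap_Suc_gt: "digamma_gap a (Suc n) > digamma_gap a n"
proof -
  have "2 * ((a + n) * (1 - a + n)) < (1 + 2 * real n) * (real n + 1)"
    using quarter_bound[of a] by (simp add: algebra_simps)
  moreover have p: "a + n > 0" "1 - a + n > 0" using a by (auto intro: add_pos_nonneg)
  moreover have "1 / (a + n) + 1 / (1 - a + n) = (1 + 2 * real n) / ((a + n) * (1 - a + n))"
    using p by (simp add: divide_simps)
  moreover have "0 < (a + n) * (1 - a + n)" using p by simp
  ultimately have "1 / (a + n) + 1 / (1 - a + n) > 2 / (real n + 1)"
    by (simp add: divide_simps)
  then show ?thesis by (simp add: digamma_gap_Suc)
qed

lemma mono_digamma_gap: "mono (digamma_gap a)"
  using digamma_gap_Suc_gt by (intro mono_iff_le_Suc[THEN iffD2] allI less_imp_le)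

lemma digamma_gap_bounds: "0 \<le> digamma_gap a n" "digamma_gap a n \<le> (1 / a + 1 / (1 - a)) * n"
proof -
  show "0 \<le> digamma_gap a n" using monoD[OF mono_digamma_gap, of 0 n] by (simp add: digamma_gap_def)
  have "digamma_gap a n \<le> (\<Sum>k<n. 1 / a + 1 / (1 - a))"
    unfolding digamma_gap_def
  proof (rule sum_mono)
    fix k :: nat
    have "1 / (a + k) \<le> 1 / a" "1 / (1 - a + k) \<le> 1 / (1 - a)" using a by (auto intro!: divide_left_mono)
    moreover have "2 / (real k + 1) \<ge> 0" by simp
    ultimately show "1 / (a + k) + 1 / (1 - a + k) - 2 / (real k + 1) \<le> 1 / a + 1 / (1 - a)" by linarith
  qed
  then show "digamma_gap a n \<le> (1 / a + 1 / (1 - a)) * n" by (simp add: mult_ac)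
qed

lemma hyp_fps_ode:
  "fps_deriv (fps_X * (1 - fps_X) * fps_deriv (hyp_fps a)) = fps_const (a * (1 - a)) * hyp_fps a"
proof (rule fps_ext)
  fix n
  show "fps_nth (fps_deriv (fps_X * (1 - fps_X) * fps_deriv (hyp_fps a))) n
      = fps_nth (fps_const (a * (1 - a)) * hyp_fps a) n"
    unfolding fps_nth_hypergeom_operator
    using hyp_coeff_Suc[of n a] by (simp add: hyp_fps_def algebra_simps)
qed

text \<open>Equivalent to the hypergeometric equation for \<open>F(x) ln x + E(x)\<close>; the last two terms are, up to sign, what the
  derivatives of \<open>ln x\<close> contribute.\<close>

lemma log_fps_ode:
  "fps_deriv (fps_X * (1 - fps_X) * fps_deriv (log_fps a))
     = fps_const (a * (1 - a)) * log_fps a + hyp_fps a - 2 * (1 - fps_X) * fps_deriv (hyp_fps a)"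
proof (rule fps_ext)
  fix n
  define c c' d where "c = hyp_coeff a n" and "c' = hyp_coeff a (Suc n)" and "d = digamma_gap a n"
  have p: "a + n > 0" "1 - a + n > 0" using a by (auto intro: add_pos_nonneg)
  define P where "P = (a + n) * (1 - a + n)"
  have P: "P = real n * (n + 1) + a * (1 - a)" by (simp add: P_def algebra_simps)
  define \<delta> where "\<delta> = 1 / (a + n) + 1 / (1 - a + n) - 2 / (real n + 1)"
  have c': "(real n + 1)\<^sup>2 * c' = P * c" using hyp_coeff_Suc[of n a] by (simp add: c_def c'_def P_def)
  have "P * \<delta> = (2 * real n + 1) - 2 * P / (real n + 1)"
    using p by (simp add: P_def \<delta>_def divide_simps)
  then have "c * (P * \<delta>) = c * ((2 * real n + 1) - 2 * P / (real n + 1))" by simp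
  also have "\<dots> = c * (2 * real n + 1) - 2 * ((P * c) / (real n + 1))" by (simp add: algebra_simps)
  also have "(P * c) / (real n + 1) = (real n + 1) * c'"
    unfolding c'[symmetric] by (simp add: power2_eq_square)
  finally have D: "P * c * \<delta> = c * (2 * real n + 1) - 2 * ((real n + 1) * c')"
    by (simp add: mult_ac)
  have "fps_nth (fps_deriv (fps_X * (1 - fps_X) * fps_deriv (log_fps a))) n
      = (real n + 1)\<^sup>2 * (c' * (d + \<delta>)) - real n * (real n + 1) * (c * d)"
    unfolding fps_nth_hypergeom_operator
    by (simp add: log_fps_def c_def c'_def d_def \<delta>_def digamma_gap_Suc)
  also have "\<dots> = P * c * (d + \<delta>) - real n * (real n + 1) * (c * d)"
    unfolding c'[symmetric] by simp
  also have "\<dots> = a * (1 - a) * (c * d) + P * c * \<delta>"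
    by (simp add: P algebra_simps)
  also have "\<dots> = a * (1 - a) * (c * d) + c - 2 * ((real n + 1) * c' - real n * c)"
    unfolding D by (simp add: algebra_simps)
  also have "\<dots> = fps_nth (fps_const (a * (1 - a)) * log_fps a + hyp_fps a - 2 * (1 - fps_X) * fps_deriv (hyp_fps a)) n"
    by (cases n) (simp_all add: hyp_fps_def log_fps_def c_def c'_def d_def algebra_simps fps_X_mult_nth numeral_fps_const)
  finally show "fps_nth (fps_deriv (fps_X * (1 - fps_X) * fps_deriv (log_fps a))) n = \<dots>" .
qed

text \<open>The left-hand side is \<open>x(1-x)\<close> times the Wronskian of \<open>F\<close> and \<open>F ln x + E\<close>, in which the logarithm cancels.
  It can therefore be handled formally: its derivative is zero and its constant term is \<open>1\<close>.\<close>

lemma fps_wronskian: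
  fixes F E :: "real fps"
  defines "F \<equiv> hyp_fps a" and "E \<equiv> log_fps a"
  shows "fps_X * (1 - fps_X) * (fps_deriv E * F - E * fps_deriv F) + (1 - fps_X) * F\<^sup>2 = 1"
proof -
  define \<Phi> where "\<Phi> = fps_X * (1 - fps_X) * (fps_deriv E * F - E * fps_deriv F) + (1 - fps_X) * F\<^sup>2"
  define p q where "p = fps_X * (1 - fps_X) * fps_deriv F" and "q = fps_X * (1 - fps_X) * fps_deriv E"
  have \<Phi>: "\<Phi> = q * F - E * p + (1 - fps_X) * F\<^sup>2" by (simp add: \<Phi>_def p_def q_def algebra_simps)
  have p': "fps_deriv p = fps_const (a * (1 - a)) * F"
    using hyp_fps_ode by (simp add: p_def F_def)
  have q': "fps_deriv q = fps_const (a * (1 - a)) * E + F - 2 * (1 - fps_X) * fps_deriv F"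
    using log_fps_ode by (simp add: q_def F_def E_def)
  have "fps_deriv \<Phi> = fps_deriv q * F + q * fps_deriv F - fps_deriv E * p - E * fps_deriv p
       + 2 * (1 - fps_X) * F * fps_deriv F - F\<^sup>2"
    by (simp add: \<Phi> power2_eq_square algebra_simps)
  also have "\<dots> = 0"
    unfolding p' q' unfolding p_def q_def by (simp add: power2_eq_square algebra_simps)
  finally have "\<Phi> = fps_const (fps_nth \<Phi> 0)" by (simp add: fps_deriv_eq_0_iff)
  moreover have "fps_nth \<Phi> 0 = 1" by (simp add: \<Phi>_def F_def hyp_fps_def power2_eq_square)
  ultimately show ?thesis by (simp add: \<Phi>_def)
qed

end

section \<open>The connection between 0 and 1\<close>

lemma Gamma_reflection_real:
  fixes x :: real
  shows "Gamma x * Gamma (1 - x) = pi / sin (pi * x)"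
proof -
  have "complex_of_real (Gamma x * Gamma (1 - x)) = complex_of_real (pi / sin (pi * x))"
    using Gamma_reflection_complex[of "complex_of_real x"] sin_of_real[of "pi * x", where 'a = complex]
    by (simp add: Gamma_complex_of_real[symmetric])
  then show ?thesis by (simp only: of_real_eq_iff)
qed

lemma harmonic_sums:
  fixes y :: real assumes "0 < y" "y < 1"
  shows "(\<lambda>n. 1 / (real n + 1) * y ^ n) sums (- ln (1 - y) / y)"
proof -
  have "(\<lambda>n. - (y ^ n) / real n) sums ln (1 - y)"
    using ln_series'[of "- y"] assms by simp
  then have "(\<lambda>n. - (y ^ Suc n) / real (Suc n)) sums ln (1 - y)"
    by (subst sums_Suc_iff) simp
  then have "(\<lambda>n. - (y ^ Suc n) / real (Suc n) * (- 1 / y)) sums (ln (1 - y) * (- 1 / y))"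
    by (rule sums_mult2)
  then show ?thesis using assms by (simp add: add_ac mult_ac)
qed

context
  fixes a :: real assumes a: "0 < a" "a < 1"
begin

lemma conv_radius_hyp_fps: "fps_conv_radius (hyp_fps a) \<ge> 1"
  by (rule fps_conv_radius_ge_1[of _ 1])
     (use hyp_coeff_pos[OF a] in \<open>auto simp: hyp_fps_def abs_of_pos intro: order_trans[OF hyp_coeff_le_1[OF a]]\<close>)

lemma hyp_coeff_digamma_gap_le:
  "hyp_coeff a n * digamma_gap a n \<le> (1 / a + 1 / (1 - a)) * (real n + 1)"
proof -
  have "hyp_coeff a n * digamma_gap a n \<le> 1 * ((1 / a + 1 / (1 - a)) * n)"
    using hyp_coeff_le_1[OF a] digamma_gap_bounds[OF a] hyp_coeff_pos[OF a]
    by (intro mult_mono) auto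
  also have "\<dots> \<le> (1 / a + 1 / (1 - a)) * (real n + 1)" unfolding mult_1_left using a by (intro mult_left_mono) auto
  finally show ?thesis .
qed

lemma conv_radius_log_fps: "fps_conv_radius (log_fps a) \<ge> 1"
  by (rule fps_conv_radius_ge_1)
     (use hyp_coeff_pos[OF a] digamma_gap_bounds[OF a] hyp_coeff_digamma_gap_le in
       \<open>simp add: log_fps_def less_imp_le abs_mult\<close>)

private lemmas conv_radius_intros = less_conv_radius conv_radius_deriv_ge_1 conv_radius_mult_ge_1
  conv_radius_add_ge_1 conv_radius_diff_ge_1 conv_radius_hyp_fps conv_radius_log_fps

private abbreviation "F \<equiv> eval_fps (hyp_fps a)"
private abbreviation "F' \<equiv> eval_fps (fps_deriv (hyp_fps a))"
private abbreviation "E \<equiv> eval_fps (log_fps a)"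
private abbreviation "E' \<equiv> eval_fps (fps_deriv (log_fps a))"

lemma deriv_F: "\<bar>x\<bar> < 1 \<Longrightarrow> (F has_real_derivative F' x) (at x)"
  by (intro has_field_derivative_eval_fps conv_radius_intros)

lemma deriv_E: "\<bar>x\<bar> < 1 \<Longrightarrow> (E has_real_derivative E' x) (at x)"
  by (intro has_field_derivative_eval_fps conv_radius_intros)

lemma F_ge_1: assumes "0 \<le> x" "x < 1" shows "1 \<le> F x"
proof -
  have s: "(\<lambda>n. hyp_coeff a n * x ^ n) sums F x"
    using sums_eval_fps[of x "hyp_fps a"] assms less_conv_radius[OF _ conv_radius_hyp_fps, of x]
    by (simp add: hyp_fps_def)
  have "(\<Sum>n\<in>{0}. hyp_coeff a n * x ^ n) \<le> F x"
    unfolding sums_unique[OF s]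
    by (rule sum_le_suminf[OF sums_summable[OF s]])
       (use assms hyp_coeff_pos[OF a] in \<open>auto simp: less_imp_le\<close>)
  then show "1 \<le> F x" by simp
qed

lemma wronskian:
  assumes "\<bar>x\<bar> < 1"
  shows "x * (1 - x) * (E' x * F x - E x * F' x) + (1 - x) * (F x)\<^sup>2 = 1"
proof -
  have "eval_fps (fps_X * (1 - fps_X) * (fps_deriv (log_fps a) * hyp_fps a - log_fps a * fps_deriv (hyp_fps a))
         + (1 - fps_X) * (hyp_fps a * hyp_fps a)) x = 1"
    using fps_wronskian[OF a] by (simp add: power2_eq_square)
  then show ?thesis using assms
    by (simp add: eval_fps_add eval_fps_mult eval_fps_diff conv_radius_intros power2_eq_square)
qed

lemma deriv_p:
  assumes "\<bar>x\<bar> < 1"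
  shows "((\<lambda>x. x * (1 - x) * F' x) has_real_derivative a * (1 - a) * F x) (at x)"
proof -
  have "(eval_fps (fps_X * (1 - fps_X) * fps_deriv (hyp_fps a)) has_real_derivative
      eval_fps (fps_deriv (fps_X * (1 - fps_X) * fps_deriv (hyp_fps a))) x) (at x)"
    using assms by (intro has_field_derivative_eval_fps conv_radius_intros) auto
  also have "eval_fps (fps_deriv (fps_X * (1 - fps_X) * fps_deriv (hyp_fps a))) x = a * (1 - a) * F x"
    unfolding hyp_fps_ode[OF a] using assms by (simp add: eval_fps_mult conv_radius_intros)
  finally show ?thesis
  proof (rule has_field_derivative_transform_within_open[of _ _ _ "{-1<..<1}"])
    show "eval_fps (fps_X * (1 - fps_X) * fps_deriv (hyp_fps a)) x = x * (1 - x) * F' x" if "x \<in> {-1<..<1}" for x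
      using that by (simp add: eval_fps_mult eval_fps_diff conv_radius_intros abs_less_iff)
  qed (use assms in auto)
qed

text \<open>The logarithmic singularity of \<open>F\<close> at \<open>1\<close>, with the sharp constant: the middle expression is
  \<open>\<Sum> u\<^sub>n y\<^sup>n\<close> with \<open>u\<^sub>n \<ge> 0\<close> and \<open>\<Sum> u\<^sub>n = R(a)\<close>.\<close>

lemma hyp_log_singularity:
  assumes "0 < y" "y < 1"
  shows "0 \<le> pi / sin (pi * a) * F y + ln (1 - y) / y"
    and "pi / sin (pi * a) * F y + ln (1 - y) / y \<le> ramanujan_R a"
proof -
  define u where "u = (\<lambda>n. beta_term a (1 - a) n - 1 / (real n + 1))"
  have u: "u sums ramanujan_R a"
    using beta_term_minus_harmonic_sums[of a "1 - a"] a by (simp add: u_def ramanujan_R_def add_ac)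
  have u0: "u n \<ge> 0" for n
    using beta_term_antimono[of a 1 "1 - a" 1 n] a by (simp add: u_def beta_term_1_1)
  have nn: "z \<notin> \<int>\<^sub>\<le>\<^sub>0" if "z > 0" for z :: real
    using that by (auto elim!: nonpos_Ints_cases)
  have coeff: "pi / sin (pi * a) * hyp_coeff a n = beta_term a (1 - a) n" for n
  proof -
    have "Gamma (z + n) = Gamma z * pochhammer z n" if "z > 0" for z :: real
      using pochhammer_Gamma[OF nn[OF that], of n] that by (simp add: Gamma_eq_zero_iff nn)
    then show ?thesis using a Gamma_fact[of n, where 'a = real]
      by (simp add: beta_term_def hyp_coeff_def power2_eq_square flip: Gamma_reflection_real)
  qed
  have s: "(\<lambda>n. hyp_coeff a n * y ^ n) sums F y"
    using sums_eval_fps[of y "hyp_fps a"] assms less_conv_radius[OF _ conv_radius_hyp_fps, of y]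
    by (simp add: hyp_fps_def)
  have v: "(\<lambda>n. u n * y ^ n) sums (pi / sin (pi * a) * F y + ln (1 - y) / y)"
    using sums_diff[OF sums_mult[OF s, of "pi / sin (pi * a)"] harmonic_sums[OF assms]]
    by (simp add: u_def algebra_simps flip: coeff)
  show "0 \<le> pi / sin (pi * a) * F y + ln (1 - y) / y"
    by (rule sums_le[OF _ sums_zero v]) (use u0 assms in simp)
  show "pi / sin (pi * a) * F y + ln (1 - y) / y \<le> ramanujan_R a"
    by (rule sums_le[OF _ v u]) (use u0 assms in \<open>simp add: mult_left_le power_le_one\<close>)
qed

text \<open>The equation \<open>(x(1-x)y')' = a(1-a) y\<close> is invariant under \<open>x \<mapsto> 1 - x\<close>, so this is \<open>x(1-x)\<close> times the
  Wronskian of the two solutions \<open>F(x)\<close> and \<open>F(1-x)\<close>.\<close>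

lemma wronskian_reflection:
  "\<exists>V. \<forall>x\<in>{0<..<1}. x * (1 - x) * (F' (1 - x) * F x + F (1 - x) * F' x) = V"
proof (rule has_field_derivative_zero_constant)
  fix x :: real assume x: "x \<in> {0<..<1}"
  define p where "p = (\<lambda>x. x * (1 - x) * F' x)"
  define s where "s = a * (1 - a)"
  have p: "(p has_real_derivative s * F x) (at x)" if "\<bar>x\<bar> < 1" for x
    using deriv_p[OF that] by (simp add: p_def s_def)
  have r: "((\<lambda>x. 1 - x) has_real_derivative -1) (at x)" by (auto intro!: derivative_eq_intros)
  have p1: "((\<lambda>x. p (1 - x)) has_real_derivative s * F (1 - x) * -1) (at x)"
    by (rule DERIV_chain2[OF p r]) (use x in auto)
  have F1: "((\<lambda>x. F (1 - x)) has_real_derivative F' (1 - x) * -1) (at x)"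
    by (rule DERIV_chain2[OF deriv_F r]) (use x in auto)
  have F0: "(F has_real_derivative F' x) (at x)" and p0: "(p has_real_derivative s * F x) (at x)"
    using x by (auto intro!: deriv_F p)
  have "((\<lambda>x. p (1 - x) * F x + F (1 - x) * p x) has_real_derivative
     (s * F (1 - x) * -1 * F x + F' x * p (1 - x)) + (F' (1 - x) * -1 * p x + s * F x * F (1 - x))) (at x)"
    by (intro DERIV_add DERIV_mult p1 F0 F1 p0)
  also have "(s * F (1 - x) * -1 * F x + F' x * p (1 - x)) + (F' (1 - x) * -1 * p x + s * F x * F (1 - x)) = 0"
    by (simp add: p_def algebra_simps)
  finally show "((\<lambda>x. x * (1 - x) * (F' (1 - x) * F x + F (1 - x) * F' x)) has_real_derivative 0) (at x within {0<..<1})"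
    by (simp add: p_def algebra_simps has_field_derivative_at_within)
qed auto

text \<open>The derivatives of \<open>F(1-x)/F(x)\<close> and of \<open>ln x + E(x)/F(x)\<close> are both constant multiples of
  \<open>1 / (x(1-x) F(x)\<^sup>2)\<close>. The factor \<open>w\<close> between them and the constant \<open>C\<close> are both read off at \<open>x \<rightarrow> 0\<close> from the
  boundedness of \<open>B(x) = k F(1-x) + ln x / (1-x)\<close>. In truth \<open>C = R(a)\<close>; the inequality is what absolute
  monotonicity needs, and it follows from an upper bound for \<open>B\<close> alone.\<close>

theorem hypergeom_connection:
  "\<exists>C \<le> ramanujan_R a. \<forall>x\<in>{0<..<1}. pi / sin (pi * a) * F (1 - x) / F x + ln x + E x / F x = C"
proof -
  define k where "k = pi / sin (pi * a)"
  from wronskian_reflection obtain V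
    where V: "\<And>x. x \<in> {0<..<1} \<Longrightarrow> x * (1 - x) * (F' (1 - x) * F x + F (1 - x) * F' x) = V" by blast
  define w where "w = k * V"
  have "\<exists>C. \<forall>x\<in>{0<..<1}. k * F (1 - x) / F x + w * (ln x + E x / F x) = C"
  proof (rule has_field_derivative_zero_constant)
    fix x :: real assume x: "x \<in> {0<..<1}"
    have Fp: "F x > 0" using F_ge_1[of x] x by auto
    have r: "((\<lambda>x. 1 - x) has_real_derivative -1) (at x)" by (auto intro!: derivative_eq_intros)
    have F1: "((\<lambda>x. F (1 - x)) has_real_derivative F' (1 - x) * -1) (at x)"
      by (rule DERIV_chain2[OF deriv_F r]) (use x in auto)
    have F0: "(F has_real_derivative F' x) (at x)" and E0: "(E has_real_derivative E' x) (at x)"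
      using x by (auto intro!: deriv_F deriv_E)
    have d: "((\<lambda>x. k * F (1 - x) / F x + w * (ln x + E x / F x)) has_real_derivative
       (k * (F' (1 - x) * -1) * F x - k * F (1 - x) * F' x) / (F x * F x)
        + w * (1 / x + (E' x * F x - E x * F' x) / (F x * F x))) (at x)"
      using x Fp by (intro DERIV_add DERIV_divide DERIV_cmult F1 F0 E0 DERIV_ln_divide) auto
    have "x * (1 - x) * (F x * F x) * ((k * (F' (1 - x) * -1) * F x - k * F (1 - x) * F' x) / (F x * F x)
        + w * (1 / x + (E' x * F x - E x * F' x) / (F x * F x)))
      = - (k * (x * (1 - x) * (F' (1 - x) * F x + F (1 - x) * F' x)))
         + w * (x * (1 - x) * (E' x * F x - E x * F' x) + (1 - x) * (F x)\<^sup>2)"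
      using x Fp by (simp add: power2_eq_square field_simps)
    also have "\<dots> = 0" using V[OF x] wronskian[of x] x by (simp add: w_def)
    finally have "(k * (F' (1 - x) * -1) * F x - k * F (1 - x) * F' x) / (F x * F x)
        + w * (1 / x + (E' x * F x - E x * F' x) / (F x * F x)) = 0"
      using x Fp by simp
    with d show "((\<lambda>x. k * F (1 - x) / F x + w * (ln x + E x / F x)) has_real_derivative 0) (at x within {0<..<1})"
      by (simp add: has_field_derivative_at_within)
  qed auto
  then obtain C where C: "\<And>x. x \<in> {0<..<1} \<Longrightarrow> k * F (1 - x) / F x + w * (ln x + E x / F x) = C" by blast
  define R where "R = ramanujan_R a"
  define B where "B = (\<lambda>x. k * F (1 - x) + ln x / (1 - x))"
  have B: "0 \<le> B x" "B x \<le> R" if "x \<in> {0<..<1}" for x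
    using hyp_log_singularity[of "1 - x"] that by (auto simp: B_def k_def R_def)
  have eq: "C * F x - w * E x - B x = ln x * (w * F x - 1 / (1 - x))" if x: "x \<in> {0<..<1}" for x
  proof -
    have "F x > 0" using F_ge_1[of x] x by auto
    then show ?thesis unfolding C[OF x, symmetric] B_def using x by (simp add: field_simps)
  qed
  \<comment> \<open>Dividing \<open>eq\<close> by \<open>ln x\<close>, the left-hand side tends to \<open>0\<close> and the right-hand side to \<open>w - 1\<close>.\<close>
  have near: "eventually (\<lambda>x::real. x \<in> {0<..<1}) (at_right 0)"
    by (rule eventually_at_right_real) simp
  have F0: "F 0 = 1" and E0: "E 0 = 0"
    by (simp_all add: eval_fps_at_0 hyp_fps_def log_fps_def digamma_gap_def)
  have limF: "(F \<longlongrightarrow> 1) (at_right 0)"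
    using deriv_F[of 0, THEN DERIV_isCont] F0 by (auto simp: isCont_def intro: tendsto_within_subset)
  have limE: "(E \<longlongrightarrow> 0) (at_right 0)"
    using deriv_E[of 0, THEN DERIV_isCont] E0 by (auto simp: isCont_def intro: tendsto_within_subset)
  have ln_inv: "((\<lambda>x::real. 1 / ln x) \<longlongrightarrow> 0) (at_right 0)" by real_asymp
  have limB: "((\<lambda>x. B x / ln x) \<longlongrightarrow> 0) (at_right 0)"
  proof (rule tendsto_sandwich)
    show "((\<lambda>x. R * (1 / ln x)) \<longlongrightarrow> 0) (at_right 0)"
      by (rule tendsto_mult_right_zero[OF ln_inv])
    show "eventually (\<lambda>x. R * (1 / ln x) \<le> B x / ln x) (at_right 0)"
      using near by eventually_elim (use B in \<open>auto simp: divide_right_mono_neg\<close>)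
    show "eventually (\<lambda>x. B x / ln x \<le> 0) (at_right 0)"
      using near by eventually_elim (use B in \<open>auto simp: divide_le_0_iff\<close>)
  qed auto
  have "((\<lambda>x. (C * F x - w * E x) * (1 / ln x) - B x / ln x) \<longlongrightarrow> (C * 1 - w * 0) * 0 - 0) (at_right 0)"
    by (intro tendsto_intros limF limE limB ln_inv)
  moreover have "eventually (\<lambda>x. (C * F x - w * E x) * (1 / ln x) - B x / ln x = w * F x - 1 / (1 - x)) (at_right 0)"
    using near
  proof eventually_elim
    case (elim x)
    then have "ln x \<noteq> 0" by simp
    have "(C * F x - w * E x) * (1 / ln x) - B x / ln x = (C * F x - w * E x - B x) / ln x"
      by (simp add: diff_divide_distrib)
    then show ?case unfolding eq[OF elim] using \<open>ln x \<noteq> 0\<close> by simp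
  qed
  ultimately have "((\<lambda>x. w * F x - 1 / (1 - x)) \<longlongrightarrow> 0) (at_right 0)"
    by (simp add: tendsto_cong)
  moreover have "((\<lambda>x. w * F x - 1 / (1 - x)) \<longlongrightarrow> w * 1 - 1 / (1 - 0)) (at_right 0)"
    by (intro tendsto_intros limF) auto
  ultimately have w: "w = 1"
    using tendsto_unique[OF trivial_limit_at_right_real] by fastforce
  \<comment> \<open>In \<open>eq\<close> with \<open>w = 1\<close>, the factor of \<open>ln x\<close> is \<open>O(x)\<close>, so the logarithm disappears in the limit.\<close>
  have "C * 1 - 0 \<le> R - 0"
  proof (rule tendsto_le[OF trivial_limit_at_right_real])
    show "((\<lambda>x. C * F x - E x) \<longlongrightarrow> C * 1 - 0) (at_right 0)"
      by (intro tendsto_intros limF limE)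
    show "((\<lambda>x. R - x * ln x / (1 - x)) \<longlongrightarrow> R - 0) (at_right 0)"
      by real_asymp
    show "eventually (\<lambda>x. C * F x - E x \<le> R - x * ln x / (1 - x)) (at_right 0)"
      using near
    proof eventually_elim
      case (elim x)
      then have "ln x \<le> 0" and F: "F x \<ge> 1" using F_ge_1[of x] by auto
      have "1 / (1 - x) = 1 + x / (1 - x)" using elim by (simp add: field_simps)
      then have "F x - 1 / (1 - x) \<ge> - (x / (1 - x))" using F by simp
      from mult_left_mono_neg[OF this \<open>ln x \<le> 0\<close>]
      have "ln x * (F x - 1 / (1 - x)) \<le> - (x * ln x / (1 - x))" by (simp add: mult_ac)
      then show ?case using eq[OF elim] B(2)[OF elim] w by simp
    qed
  qed
  then have "C \<le> ramanujan_R a" by (simp add: R_def)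
  with C w show ?thesis by (auto simp: k_def add_ac)
qed

end

section \<open>Absolute monotonicity\<close>

theorem mainTheorem2:
  fixes a :: real
  assumes "a \<in> {0<..1/2}"
  shows "absolutely_monotonic_on {0<..<1} (\<lambda>r. ramanujan_R a / 2 - groetzsch_mu a r - ln r)
    \<and> strict_antimono_on {0<..<1} (\<lambda>r. groetzsch_mu a r + ln r)
    \<and> concave_on {0<..<1} (\<lambda>r. groetzsch_mu a r + ln r)"
proof -
  have a: "0 < a" "a < 1" using assms by auto
  define F E where "F = eval_fps (hyp_fps a)" and "E = eval_fps (log_fps a)"
  obtain C where C: "C \<le> ramanujan_R a"
    "\<And>x. x \<in> {0<..<1} \<Longrightarrow> pi / sin (pi * a) * F (1 - x) / F x + ln x + E x / F x = C"
    using hypergeom_connection[OF a] unfolding F_def E_def by blast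
  define q where "q = log_fps a * inverse (hyp_fps a)"
  have q_alt: "q = Abs_fps (\<lambda>n. fps_nth (hyp_fps a) n * digamma_gap a n) * inverse (hyp_fps a)"
    by (simp add: q_def log_fps_def hyp_fps_def)
  have q: "0 \<le> fps_nth q n" "fps_nth q n \<le> hyp_coeff a n * digamma_gap a n" for n
    using fps_quotient_nonneg[of "hyp_fps a" "digamma_gap a" n]
      hyp_coeff_pos[OF a] hyp_coeff_log_convex[OF a] mono_digamma_gap[OF a] digamma_gap_bounds(1)[OF a, of 0]
    unfolding q_alt[symmetric] by (simp_all add: hyp_fps_def)
  have q_rad: "fps_conv_radius q \<ge> 1"
    by (rule fps_conv_radius_ge_1)
       (use q hyp_coeff_digamma_gap_le[OF a] in \<open>auto intro: order_trans\<close>)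
  have q_eval: "eval_fps q x = E x / F x" if "x \<in> {0<..<1}" for x
  proof -
    have "q * hyp_fps a = log_fps a * (inverse (hyp_fps a) * hyp_fps a)"
      by (simp add: q_def mult_ac)
    also have "inverse (hyp_fps a) * hyp_fps a = 1"
      by (rule inverse_mult_eq_1) (simp add: hyp_fps_def)
    finally have "log_fps a = q * hyp_fps a" by simp
    then have "E x = eval_fps (q * hyp_fps a) x" by (simp add: E_def)
    also have "\<dots> = eval_fps q x * F x"
      unfolding F_def using that
      by (intro eval_fps_mult less_conv_radius(1) conv_radius_hyp_fps[OF a] q_rad) auto
    finally have "E x = eval_fps q x * F x" .
    moreover have "F x \<ge> 1" using F_ge_1[OF a, of x] that by (simp add: F_def)
    ultimately show ?thesis by (simp add: field_simps)
  qed
  have q1: "fps_nth q 1 > 0"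
  proof -
    have "fps_nth q 1 = hyp_coeff a 1 * digamma_gap a 1"
      by (simp add: q_def fps_mult_nth log_fps_def hyp_fps_def digamma_gap_def)
    also have "\<dots> > 0"
      using hyp_coeff_pos[OF a, of 1] digamma_gap_Suc_gt[OF a, of 0] by (simp add: digamma_gap_def)
    finally show ?thesis .
  qed
  \<comment> \<open>The Taylor series in \<open>r\<close>, obtained from \<open>q\<close> by \<open>x = r\<^sup>2\<close>.\<close>
  define p where "p = fps_const ((ramanujan_R a - C) / 2)
     + fps_const (1 / 2) * Abs_fps (\<lambda>n. if even n then fps_nth q (n div 2) else 0)"
  define K where "K = 1 / a + 1 / (1 - a)"
  have even_rad: "fps_conv_radius (Abs_fps (\<lambda>n. if even n then fps_nth q (n div 2) else 0)) \<ge> 1"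
  proof (rule fps_conv_radius_ge_1)
    fix n
    have "hyp_coeff a m * digamma_gap a m \<le> K * (real (2 * m) + 1)" for m
    proof -
      have "K * (real m + 1) \<le> K * (real (2 * m) + 1)" using a by (intro mult_left_mono) (auto simp: K_def)
      then show ?thesis using hyp_coeff_digamma_gap_le[OF a, of m] by (simp add: K_def)
    qed
    then show "\<bar>fps_nth (Abs_fps (\<lambda>n. if even n then fps_nth q (n div 2) else 0)) n\<bar> \<le> K * (real n + 1)"
      using q a order_trans by (auto simp: K_def elim!: evenE) blast
  qed
  have p_rad: "fps_conv_radius p \<ge> 1"
    unfolding p_def by (intro conv_radius_add_ge_1 conv_radius_mult_ge_1 even_rad) auto
  have p_nonneg: "fps_nth p n \<ge> 0" for n
    using q(1) C(1) by (cases n) (auto simp: p_def)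
  define f where "f = (\<lambda>r. ramanujan_R a / 2 - groetzsch_mu a r - ln r)"
  have f: "f r = eval_fps p r" if r: "r \<in> {0<..<1}" for r
  proof -
    have r2: "r\<^sup>2 \<in> {0<..<1}" using r by (auto simp: abs_square_less_1 abs_less_iff)
    define X Y where "X = pi / sin (pi * a) * F (1 - r\<^sup>2) / F (r\<^sup>2)" and "Y = E (r\<^sup>2) / F (r\<^sup>2)"
    have mu: "groetzsch_mu a r = X / 2"
      by (simp add: groetzsch_mu_def hypergeom_F_eq_eval_fps F_def X_def)
    have ln: "ln (r\<^sup>2) = 2 * ln r" using r by (simp add: ln_realpow)
    have L: "ereal (norm r) < fps_conv_radius g" if "fps_conv_radius g \<ge> 1" for g :: "real fps"
      using r by (intro less_conv_radius(1) that) auto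
    have p: "eval_fps p r = (ramanujan_R a - C) / 2 + Y / 2"
      using r even_rad q_rad q_eval[OF r2] unfolding p_def Y_def
      by (simp add: eval_fps_add[OF L L] eval_fps_mult[OF L L] conv_radius_mult_ge_1 eval_even_fps)
    have "C = X + 2 * ln r + Y" using C(2)[OF r2] ln by (simp only: X_def Y_def)
    then show ?thesis unfolding f_def mu p by (simp add: field_simps)
  qed
  obtain D where D: "D 0 = f" "\<And>n. D (Suc n) = eval_fps ((fps_deriv ^^ Suc n) p)"
    "\<And>n x. x \<in> {0<..<1} \<Longrightarrow> (D n has_real_derivative D (Suc n) x) (at x)"
    "\<And>n x. x \<in> {0<..<1} \<Longrightarrow> D n x \<ge> 0"
    using derivatives_of_nonneg_power_series[OF p_rad p_nonneg f] by blast
  have "absolutely_monotonic_on {0<..<1} f"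
    unfolding absolutely_monotonic_on_def
    using D(1,3,4) by (intro exI[of _ D]) (auto intro: has_field_derivative_at_within)
  moreover have mu: "(\<lambda>r. groetzsch_mu a r + ln r) = (\<lambda>r. ramanujan_R a / 2 - f r)"
    by (simp add: f_def)
  have D1_pos: "D 1 x > 0" if x: "x \<in> {0<..<1}" for x
  proof -
    have "D 1 x = eval_fps (fps_deriv p) x" using D(2)[of 0] by simp
    moreover have "(\<lambda>n. fps_nth (fps_deriv p) n * x ^ n) sums eval_fps (fps_deriv p) x"
      using x by (intro sums_eval_fps less_conv_radius(1) conv_radius_deriv_ge_1 p_rad) auto
    ultimately have s: "(\<lambda>n. fps_nth (fps_deriv p) n * x ^ n) sums D 1 x" by simp
    have "0 < fps_nth (fps_deriv p) 1 * x ^ 1" using q1 x by (simp add: p_def)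
    also have "\<dots> = (\<Sum>n\<in>{1}. fps_nth (fps_deriv p) n * x ^ n)" by simp
    also have "\<dots> \<le> D 1 x"
      unfolding sums_unique[OF s]
      by (rule sum_le_suminf[OF sums_summable[OF s]]) (use x p_nonneg in auto)
    finally show ?thesis .
  qed
  have "strict_antimono_on {0<..<1} (\<lambda>r. groetzsch_mu a r + ln r)"
    unfolding mu
  proof (rule monotone_onI)
    fix x y :: real assume xy: "x \<in> {0<..<1}" "y \<in> {0<..<1}" "x < y"
    have "f x < f y"
    proof (rule DERIV_pos_imp_increasing[OF xy(3)])
      fix z assume "x \<le> z" "z \<le> y"
      then have "z \<in> {0<..<1}" using xy by auto
      then show "\<exists>d. (f has_real_derivative d) (at z) \<and> d > 0"
        using D(3)[of z 0] D1_pos[of z] by (auto simp: D(1))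
    qed
    then show "ramanujan_R a / 2 - f x > ramanujan_R a / 2 - f y" by simp
  qed
  moreover have "concave_on {0<..<1} (\<lambda>r. groetzsch_mu a r + ln r)"
    unfolding mu concave_on_def
  proof (rule f''_ge0_imp_convex)
    fix x :: real assume x: "x \<in> {0<..<1}"
    show "((\<lambda>r. - (ramanujan_R a / 2 - f r)) has_real_derivative D 1 x) (at x)"
      using D(3)[OF x, of 0] by (auto simp: D(1) intro!: derivative_eq_intros)
    show "(D 1 has_real_derivative D 2 x) (at x)" using D(3)[OF x, of 1] by (simp add: numeral_2_eq_2)
    show "0 \<le> D 2 x" by (rule D(4)[OF x])
  qed auto
  ultimately show ?thesis by (simp add: f_def)
qed

end
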